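(* Let $C$ be a bivariate copula, let $S$ be a bivariate copula with $S^t=S$, and let $\alpha\in[0,1]$. Define $D_\alpha:=\alpha C+(1-\alpha)S$. Then, for every $p\in[1,+\infty]$, $$\mu_p(D_\alpha)\;=\;\alpha\,\mu_p(C).$$
   Context: A (bivariate) copula is a function $C:[0,1]^2\to[0,1]$ with $C(t,0)=C(0,t)=0$, $C(t,1)=C(1,t)=t$ for all $t\in[0,1]$, and $C(u',v')-C(u,v')-C(u',v)+C(u,v)\ge 0$ whenever $u\le u'$, $v\le v'$ in $[0,1]$. The transpose is $C^t(u,v)=C(v,u)$. For $p\in[1,\infty)$, $\mu_p(C)=\left(\int_{[0,1]^2}|C(u,v)-C(v,u)|^p\,du\,dv\right)^{1/p}$, and $\mu_\infty(C)=\sup_{(u,v)\in[0,1]^2}|C(u,v)-C(v,u)|$. *)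

theory Defs
  imports "HOL-Analysis.Analysis"
begin

(* A function on the unit square is represented by a total function on pairs of reals.
   All definitions below look only at its values on the unit square. *)

definition copula :: "(real \<Rightarrow> real \<Rightarrow> real) \<Rightarrow> bool" where
  "copula C \<longleftrightarrow>
     (\<forall>u\<in>{0..1}. \<forall>v\<in>{0..1}. C u v \<in> {0..1}) \<and>
     (\<forall>t\<in>{0..1}. C t 0 = 0 \<and> C 0 t = 0 \<and> C t 1 = t \<and> C 1 t = t) \<and>
     (\<forall>u\<in>{0..1}. \<forall>u'\<in>{0..1}. \<forall>v\<in>{0..1}. \<forall>v'\<in>{0..1}.
        u \<le> u' \<longrightarrow> v \<le> v' \<longrightarrow> C u' v' - C u v' - C u' v + C u v \<ge> 0)"

definition transpose_copula :: "(real \<Rightarrow> real \<Rightarrow> real) \<Rightarrow> real \<Rightarrow> real \<Rightarrow> real" where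
  "transpose_copula C = (\<lambda>u v. C v u)"

(* S and its transpose are equal as functions on the unit square. *)
definition symmetric_copula :: "(real \<Rightarrow> real \<Rightarrow> real) \<Rightarrow> bool" where
  "symmetric_copula S \<longleftrightarrow>
     copula S \<and> (\<forall>u\<in>{0..1}. \<forall>v\<in>{0..1}. transpose_copula S u v = S u v)"

definition convex_mix ::
    "real \<Rightarrow> (real \<Rightarrow> real \<Rightarrow> real) \<Rightarrow> (real \<Rightarrow> real \<Rightarrow> real) \<Rightarrow> real \<Rightarrow> real \<Rightarrow> real" where
  "convex_mix \<alpha> C S = (\<lambda>u v. \<alpha> * C u v + (1 - \<alpha>) * S u v)"

(* Intended for exponents p with 1 \<le> p \<le> \<infinity>. Note that 0 powr x = 0 for every x. *)
definition mu :: "ereal \<Rightarrow> (real \<Rightarrow> real \<Rightarrow> real) \<Rightarrow> real" where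
  "mu p C =
     (if p = \<infinity>
      then (SUP (u, v)\<in>{0..1} \<times> {0..1}. \<bar>C u v - C v u\<bar>)
      else (LINT (u, v):{0..1} \<times> {0..1}|lborel. \<bar>C u v - C v u\<bar> powr real_of_ereal p)
             powr (1 / real_of_ereal p))"

lemma copula_convex_mix:
  assumes C: "copula C" and S: "copula S" and a: "\<alpha> \<in> {0..1}"
  shows "copula (convex_mix \<alpha> C S)"
proof -
  have "0 \<le> \<alpha> * x + (1 - \<alpha>) * y" if "0 \<le> x" "0 \<le> y" for x y :: real
    using a that by simp
  moreover have "\<alpha> * x + (1 - \<alpha>) * y \<le> 1" if "x \<le> 1" "y \<le> 1" for x y :: real
    using a that convex_bound_le[of x 1 y \<alpha> "1 - \<alpha>"] by simp
  moreover have "\<alpha> * a' + (1 - \<alpha>) * a'' - (\<alpha> * b' + (1 - \<alpha>) * b'')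
      - (\<alpha> * c' + (1 - \<alpha>) * c'') + (\<alpha> * d' + (1 - \<alpha>) * d'')
      = \<alpha> * (a' - b' - c' + d') + (1 - \<alpha>) * (a'' - b'' - c'' + d'')"
    for a' a'' b' b'' c' c'' d' d'' :: real
    by (simp add: algebra_simps)
  moreover have "\<alpha> * t + (1 - \<alpha>) * t = t" for t :: real
    by (simp add: algebra_simps)
  ultimately show ?thesis
    using C S unfolding copula_def convex_mix_def by simp
qed

end

theory Submission
  imports Defs
begin

text \<open>In D(u,v) - D(v,u) the symmetric summand cancels, so on the unit square the asymmetry of
  the mixture is exactly \<alpha> times that of C (\<open>convex_mix_asymmetry\<close>). Both kinds
  of \<open>mu\<close> are positively homogeneous in |C(u,v) - C(v,u)|: a factor \<alpha> \<ge> 0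
  leaves a bounded supremum (\<open>cSUP_mult_left_real\<close>), and leaves the integral as
  \<alpha>^p, which the outer p-th root turns back into \<alpha>.\<close>

lemma convex_mix_asymmetry:
  assumes "symmetric_copula S" "0 \<le> \<alpha>" "u \<in> {0..1}" "v \<in> {0..1}"
  shows "\<bar>convex_mix \<alpha> C S u v - convex_mix \<alpha> C S v u\<bar> = \<alpha> * \<bar>C u v - C v u\<bar>"
proof -
  have "S v u = S u v"
    using assms unfolding symmetric_copula_def transpose_copula_def by blast
  then have "convex_mix \<alpha> C S u v - convex_mix \<alpha> C S v u = \<alpha> * (C u v - C v u)"
    by (simp add: convex_mix_def algebra_simps)
  then show ?thesis
    using assms(2) by (simp add: abs_mult)
qed

text \<open>Two numbers in [0,1] differ by at most 1. This supplies the upper bound that a real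
  supremum needs.\<close>

lemma copula_asymmetry_le_one:
  assumes "copula C" "u \<in> {0..1}" "v \<in> {0..1}"
  shows "\<bar>C u v - C v u\<bar> \<le> 1"
proof -
  have "C u v \<in> {0..1}" "C v u \<in> {0..1}"
    using assms unfolding copula_def by blast+
  then show ?thesis by auto
qed

text \<open>Multiplication by c \<ge> 0 is continuous and monotone, hence commutes with suprema of
  nonempty bounded sets; c = 0 is covered.\<close>

lemma cSUP_mult_left_real:
  fixes f :: "'a \<Rightarrow> real"
  assumes "0 \<le> c" "A \<noteq> {}" "bdd_above (f ` A)"
  shows "(SUP x\<in>A. c * f x) = c * (SUP x\<in>A. f x)"
proof -
  have "mono (\<lambda>x. c * x)"
    using assms(1) by (auto intro!: monoI mult_left_mono)
  then have "c * Sup (f ` A) = (SUP y\<in>f ` A. c * y)"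
    by (rule continuous_at_Sup_mono) (use assms in \<open>auto intro!: continuous_intros\<close>)
  then show ?thesis
    by (simp add: image_image)
qed

theorem proposition7:
  fixes C S :: "real \<Rightarrow> real \<Rightarrow> real" and \<alpha> :: real and p :: ereal
  assumes "copula C"
    and "symmetric_copula S"
    and "\<alpha> \<in> {0..1}"
    and "1 \<le> p"
  shows "mu p (convex_mix \<alpha> C S) = \<alpha> * mu p C"
proof -
  let ?Q = "{0..1::real} \<times> {0..1::real}"
  let ?D = "convex_mix \<alpha> C S"
  have \<alpha>: "0 \<le> \<alpha>"
    using assms(3) by simp
  note scale = convex_mix_asymmetry[OF assms(2) \<alpha>, of _ _ C]
  show ?thesis
  proof (cases "p = \<infinity>")
    case True
    have "(SUP (u, v)\<in>?Q. \<bar>?D u v - ?D v u\<bar>) = (SUP x\<in>?Q. \<alpha> * (case x of (u, v) \<Rightarrow> \<bar>C u v - C v u\<bar>))"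
      by (rule SUP_cong) (auto simp: scale)
    also have "\<dots> = \<alpha> * (SUP (u, v)\<in>?Q. \<bar>C u v - C v u\<bar>)"
    proof (rule cSUP_mult_left_real[OF \<alpha>])
      show "bdd_above ((\<lambda>(u, v). \<bar>C u v - C v u\<bar>) ` ?Q)"
        using copula_asymmetry_le_one[OF assms(1)] by (intro bdd_aboveI2[where M = 1]) auto
    qed simp
    finally show ?thesis
      using True by (simp add: mu_def)
  next
    case False
    define q where "q = real_of_ereal p"
    \<comment> \<open>This makes q * (1/q) = 1 when the powers are combined at the end.\<close>
    have q: "q \<noteq> 0"
      using assms(4) False unfolding q_def by (cases p) auto
    let ?I = "LINT (u, v):?Q|lborel. \<bar>C u v - C v u\<bar> powr q"
    have "(LINT (u, v):?Q|lborel. \<bar>?D u v - ?D v u\<bar> powr q)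
        = (LINT x:?Q|lborel. \<alpha> powr q * (case x of (u, v) \<Rightarrow> \<bar>C u v - C v u\<bar> powr q))"
      unfolding set_lebesgue_integral_def
      \<comment> \<open>Off the square, where S may fail to be symmetric, the indicator kills both
        integrands.\<close>
      by (rule Bochner_Integration.integral_cong)
        (auto simp: indicator_def scale powr_mult \<alpha>)
    \<comment> \<open>A real factor leaves the Bochner integral even for a non-integrable integrand,
      where both sides are 0 by default.\<close>
    also have "\<dots> = \<alpha> powr q * ?I"
      by (rule set_integral_mult_right)
    finally have "(LINT (u, v):?Q|lborel. \<bar>?D u v - ?D v u\<bar> powr q) = \<alpha> powr q * ?I" .
    \<comment> \<open>Nonnegative factors let the outer power 1/q split over
      \<open>\<alpha> powr q * ?I\<close>.\<close>
    moreover have "0 \<le> ?I"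
      unfolding set_lebesgue_integral_def by (rule integral_nonneg_AE) auto
    ultimately show ?thesis
      using False q \<alpha> by (simp add: mu_def powr_mult powr_powr flip: q_def)
  qed
qed

end
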